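(* Let $n>1$ and let $\mathscr{L}=\mathscr{L}(s,\mathbf{u},\mathbf{p})$ be a smooth first-order Lagrangian. If $\mathscr{L}$ is an $\mathcal{N}$-Lagrangian, then it is also a null Lagrangian.
   Context: A first-order Lagrangian is a smooth function $\mathscr{L}(s,\mathbf{u},\mathbf{p})$ of $s\in[0,1]$, $\mathbf{u}\in\mathbb{R}^n$, $\mathbf{p}\in\mathbb{R}^n\setminus\{\mathbf{0}\}$; its functional is $\mathcal{E}(\mathbf{u})=\int_0^1\mathscr{L}(s,\mathbf{u}(s),\mathbf{u}'(s))\,ds$. Let $\mathcal{C}^2_R$ be the set of $\mathbf{u}\in C^2([0,1];\mathbb{R}^n)$ with $\mathbf{u}'(s)\neq\mathbf{0}$ for all $s$, and let $\mathcal{C}^\infty_c$ be the smooth functions $[0,1]\to\mathbb{R}^n$ with compact support in $(0,1)$. The first variation is $\delta\mathcal{E}[\delta\mathbf{u}]=\int_0^1(\mathscr{L}_{\mathbf{u}}\cdot\delta\mathbf{u}+\mathscr{L}_{\mathbf{u}'}\cdot\delta\mathbf{u}')\,ds$, where $\mathscr{L}_{\mathbf{u}},\mathscr{L}_{\mathbf{u}'}$ are the gradients of $\mathscr{L}$ in $\mathbf{u}$ and $\mathbf{p}$ evaluated at $(s,\mathbf{u}(s),\mathbf{u}'(s))$. For $\mathbf{u}\in\mathcal{C}^2_R$ the set of normal variations is $N_{\mathbf{u}}=\{\mathbf{v}\in\mathcal{C}^\infty_c:\mathbf{v}\cdot\mathbf{u}'=0\}$. $\mathscr{L}$ is an $\mathcal{N}$-Lagrangian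 if for every $\mathbf{u}\in\mathcal{C}^2_R$, $\delta\mathcal{E}[\delta\mathbf{u}]=0$ for all $\delta\mathbf{u}\in N_{\mathbf{u}}$. $\mathscr{L}$ is a null Lagrangian if for every $\mathbf{u}\in\mathcal{C}^2_R$, $\delta\mathcal{E}[\delta\mathbf{u}]=0$ for all $\delta\mathbf{u}\in\mathcal{C}^\infty_c$ (equivalently, its Euler–Lagrange operator $\mathscr{L}_{\mathbf{u}}-D_s\mathscr{L}_{\mathbf{u}'}$ vanishes identically). *)

theory Defs
  imports "HOL-Analysis.Analysis"
begin

text \<open>
  Class \<open>C\<^sup>k\<close> on a set that need not be open: derivatives are taken within the set, hence
  one-sided at the endpoints of \<open>[0,1]\<close>. The iterated derivative is expressed through directional
  derivatives in all fixed directions, so that the type of the differentiated map stays the same.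
  Derivatives within the sets used below are unique, as these sets are convex with
  nonempty interior, or products of such a set with an open set.
\<close>

primrec Ck_on :: "nat \<Rightarrow> ('a::euclidean_space \<Rightarrow> 'b::real_normed_vector) \<Rightarrow> 'a set \<Rightarrow> bool" where
  "Ck_on 0 f S \<longleftrightarrow> continuous_on S f"
| "Ck_on (Suc k) f S \<longleftrightarrow>
     (\<exists>f'. (\<forall>x\<in>S. (f has_derivative f' x) (at x within S)) \<and> (\<forall>d. Ck_on k (\<lambda>x. f' x d) S))"

definition smooth_on :: "('a::euclidean_space \<Rightarrow> 'b::real_normed_vector) \<Rightarrow> 'a set \<Rightarrow> bool" where
  "smooth_on f S \<longleftrightarrow> (\<forall>k. Ck_on k f S)"

definition grad :: "('a::real_inner \<Rightarrow> real) \<Rightarrow> 'a \<Rightarrow> 'a" where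
  "grad f x = (THE D. GDERIV f x :> D)"

text \<open>
  Functions on \<open>[0,1]\<close> and Lagrangians are total functions of which only the values on
  \<open>[0,1]\<close>, respectively on \<open>[0,1] \<times> \<real>\<^sup>n \<times> (\<real>\<^sup>n - {0})\<close>, matter.
\<close>

definition lagrangian :: "(real \<Rightarrow> real^'n \<Rightarrow> real^'n \<Rightarrow> real) \<Rightarrow> bool" where
  "lagrangian L \<longleftrightarrow> smooth_on (\<lambda>(s, u, p). L s u p) ({0..1} \<times> UNIV \<times> (UNIV - {0}))"

definition deriv01 :: "(real \<Rightarrow> real^'n) \<Rightarrow> real \<Rightarrow> real^'n" where
  "deriv01 u s = vector_derivative u (at s within {0..1})"

definition C2R :: "(real \<Rightarrow> real^'n) set" where
  "C2R = {u. Ck_on 2 u {0..1} \<and> (\<forall>s\<in>{0..1}. deriv01 u s \<noteq> 0)}"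

definition Cinf_c :: "(real \<Rightarrow> real^'n) set" where
  "Cinf_c = {v. smooth_on v {0..1} \<and>
     compact (closure {s\<in>{0..1}. v s \<noteq> 0}) \<and> closure {s\<in>{0..1}. v s \<noteq> 0} \<subseteq> {0<..<1}}"

definition normal_variations :: "(real \<Rightarrow> real^'n) \<Rightarrow> (real \<Rightarrow> real^'n) set" where
  "normal_variations u = {v \<in> Cinf_c. \<forall>s\<in>{0..1}. v s \<bullet> deriv01 u s = 0}"

definition first_variation ::
  "(real \<Rightarrow> real^'n \<Rightarrow> real^'n \<Rightarrow> real) \<Rightarrow> (real \<Rightarrow> real^'n) \<Rightarrow> (real \<Rightarrow> real^'n) \<Rightarrow> real" where
  "first_variation L u v = integral {0..1} (\<lambda>s.
     grad (\<lambda>w. L s w (deriv01 u s)) (u s) \<bullet> v s +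
     grad (\<lambda>p. L s (u s) p) (deriv01 u s) \<bullet> deriv01 v s)"

definition N_lagrangian :: "(real \<Rightarrow> real^'n \<Rightarrow> real^'n \<Rightarrow> real) \<Rightarrow> bool" where
  "N_lagrangian L \<longleftrightarrow> (\<forall>u\<in>C2R. \<forall>v\<in>normal_variations u. first_variation L u v = 0)"

definition null_lagrangian :: "(real \<Rightarrow> real^'n \<Rightarrow> real^'n \<Rightarrow> real) \<Rightarrow> bool" where
  "null_lagrangian L \<longleftrightarrow> (\<forall>u\<in>C2R. \<forall>v\<in>Cinf_c. first_variation L u v = 0)"

end

theory Submission
  imports Defs
begin

text \<open>
  Integrating by parts, the first variation is the integral of the Euler--Lagrange expression
  \<open>E(s, u, u', u'')\<close> against the variation. Testing quadratic curves with smooth bumps shows that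
  \<open>E(s, u, p, a) \<bullet> w = 0\<close> whenever \<open>w\<close> is orthogonal to \<open>p\<close>. The part of \<open>E\<close> linear in \<open>a\<close> then says that
  \<open>L\<^sub>p\<^sub>p\<close> annihilates \<open>w\<close>, so \<open>L\<^sub>p\<close> is constant on spheres; comparing radial derivatives at two orthogonal
  points of a sphere gives \<open>L\<^sub>p\<^sub>p = 0\<close>. Hence \<open>L = A(s, u) + B(s, u) \<bullet> p\<close>, where \<open>n > 1\<close> makes the
  punctured space connected, and
  \<open>E \<bullet> w = (A\<^sub>u - B\<^sub>s) \<bullet> w + (B\<^sub>u w \<bullet> p - B\<^sub>u p \<bullet> w)\<close>. Comparing \<open>p\<close> with \<open>-p\<close> separates
  the two parts, and each vanishes identically.
\<close>

section \<open>Smooth functions and bumps\<close>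

lemma Ck_on_SucD:
  "Ck_on (Suc k) f S \<Longrightarrow> Ck_on k f S"
proof (induction k arbitrary: f)
  case 0
  then show ?case
    by (metis Ck_on.simps has_derivative_continuous_on)
next
  case (Suc k)
  then obtain f' where f': "\<forall>x\<in>S. (f has_derivative f' x) (at x within S)"
      "\<And>d. Ck_on (Suc k) (\<lambda>x. f' x d) S"
    by (auto simp only: Ck_on.simps(2)[of "Suc k"])
  then show ?case
    using Suc.IH by auto
qed

lemma Ck_on_const: "Ck_on k (\<lambda>x. c) S"
  by (induction k arbitrary: c) (auto intro!: exI[of _ "\<lambda>x d. 0"])

lemma Ck_on_ident: "Ck_on k (\<lambda>x. x) S"
  by (cases k) (auto intro!: exI[of _ "\<lambda>x d. d"] continuous_on_id Ck_on_const)

lemma Ck_on_add: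
  "Ck_on k f S \<Longrightarrow> Ck_on k g S \<Longrightarrow> Ck_on k (\<lambda>x. f x + g x) S"
proof (induction k arbitrary: f g)
  case 0
  then show ?case by (auto intro: continuous_on_add)
next
  case (Suc k)
  obtain f' g' where
      "\<forall>x\<in>S. (f has_derivative f' x) (at x within S)" "\<And>d. Ck_on k (\<lambda>x. f' x d) S"
      "\<forall>x\<in>S. (g has_derivative g' x) (at x within S)" "\<And>d. Ck_on k (\<lambda>x. g' x d) S"
    using Suc.prems by auto
  then show ?case
    using Suc.IH by (auto intro!: exI[of _ "\<lambda>x d. f' x d + g' x d"] has_derivative_add)
qed

text \<open>The product rule yields terms that pair a derivative with an undifferentiated factor, so
  the induction needs \<open>f\<close> and \<open>g\<close> themselves one class lower as well.
  Scalar multiples, products and inner products are all instances.\<close>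

lemma Ck_on_bilinear:
  assumes "bounded_bilinear pr"
  shows "Ck_on k f S \<Longrightarrow> Ck_on k g S \<Longrightarrow> Ck_on k (\<lambda>x. pr (f x) (g x)) S"
proof (induction k arbitrary: f g)
  case 0
  then show ?case by (auto intro: bounded_bilinear.continuous_on[OF assms])
next
  case (Suc k)
  obtain f' g' where
      "\<forall>x\<in>S. (f has_derivative f' x) (at x within S)" "\<And>d. Ck_on k (\<lambda>x. f' x d) S"
      "\<forall>x\<in>S. (g has_derivative g' x) (at x within S)" "\<And>d. Ck_on k (\<lambda>x. g' x d) S"
    using Suc.prems by auto
  moreover have "Ck_on k f S" "Ck_on k g S"
    using Suc.prems by (simp_all only: Ck_on_SucD)
  ultimately show ?case
    using Suc.IH
    by (auto intro!: exI[of _ "\<lambda>x d. pr (f x) (g' x d) + pr (f' x d) (g x)"] Ck_on_add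
        bounded_bilinear.FDERIV[OF assms])
qed

lemmas Ck_on_scaleR = Ck_on_bilinear[OF bounded_bilinear_scaleR]
lemmas Ck_on_mult = Ck_on_bilinear[OF bounded_bilinear_mult]
lemmas Ck_on_inner = Ck_on_bilinear[OF bounded_bilinear_inner]

lemma Ck_on_minus:
  assumes "Ck_on k f S" shows "Ck_on k (\<lambda>x. - f x) S"
  using Ck_on_scaleR[OF Ck_on_const[of k "-1"] assms] by simp

lemma Ck_on_diff:
  "Ck_on k f S \<Longrightarrow> Ck_on k g S \<Longrightarrow> Ck_on k (\<lambda>x. f x - g x) S"
  using Ck_on_add[OF _ Ck_on_minus] by fastforce

section \<open>A smooth bump built from exp(-1/x)\<close>

text \<open>The division by \<open>x ^ k\<close> makes the family closed under differentiation.\<close>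

definition flat :: "nat \<Rightarrow> real \<Rightarrow> real" where
  "flat k x = (if x > 0 then exp (- 1 / x) / x ^ k else 0)"

text \<open>From the right, substituting 1/x turns the limit into x^k / exp x at infinity; from the
  left the function is constantly zero.\<close>

lemma flat_tendsto_0: "flat k \<midarrow>0\<rightarrow> 0"
proof -
  have "(flat k \<longlongrightarrow> 0) (at_right 0)"
    unfolding filterlim_at_right_to_top
  proof (rule Lim_transform_eventually)
    show "((\<lambda>x::real. x ^ k / exp x) \<longlongrightarrow> 0) at_top"
      by (rule tendsto_power_div_exp_0)
    show "\<forall>\<^sub>F x::real in at_top. x ^ k / exp x = flat k (inverse x)"
      using eventually_gt_at_top[of "0::real"]
      by eventually_elim (simp add: flat_def exp_minus field_simps)
  qed
  moreover have "(flat k \<longlongrightarrow> 0) (at_left 0)"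
    by (rule Lim_transform_eventually[OF tendsto_const])
      (auto simp: flat_def eventually_at_filter)
  ultimately show ?thesis
    by (simp add: filterlim_split_at)
qed

lemma DERIV_flat: "(flat k has_real_derivative flat (k + 2) x - k * flat (k + 1) x) (at x)"
proof -
  consider "x > 0" | "x < 0" | "x = 0" by linarith
  then show ?thesis
  proof cases
    case 1
    \<comment> \<open>This removes the truncated exponent \<open>k - 1\<close>; for k = 0 both sides
      are 0.\<close>
    have "k * x ^ (k - 1) = k * x ^ k / x"
      using 1 by (cases k) auto
    moreover have "((\<lambda>x. exp (- 1 / x) / x ^ k) has_real_derivative
        (exp (- 1 / x) * (1 / x\<^sup>2) * x ^ k - exp (- 1 / x) * (k * x ^ (k - 1))) / (x ^ k * x ^ k)) (at x)"
      using 1 by (auto intro!: derivative_eq_intros simp: power2_eq_square)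
    ultimately have "((\<lambda>x. exp (- 1 / x) / x ^ k) has_real_derivative
        flat (k + 2) x - k * flat (k + 1) x) (at x)"
      using 1 by (simp add: flat_def diff_divide_distrib power2_eq_square mult_ac)
    then show ?thesis
      by (rule has_field_derivative_transform_within_open[of _ _ _ "{0<..}"])
        (use 1 in \<open>auto simp: flat_def\<close>)
  next
    case 2
    have "((\<lambda>x. 0) has_real_derivative flat (k + 2) x - k * flat (k + 1) x) (at x)"
      using 2 by (auto simp: flat_def)
    then show ?thesis
      by (rule has_field_derivative_transform_within_open[of _ _ _ "{..<0}"])
        (use 2 in \<open>auto simp: flat_def\<close>)
  next
    case 3
    \<comment> \<open>The difference quotient of \<open>flat k\<close> at 0 is again a member of the
      family, so its limit is already known.\<close>
    have "(\<lambda>h. (flat k (0 + h) - flat k 0) / h) = flat (k + 1)"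
      by (auto simp: flat_def fun_eq_iff)
    then have "(flat k has_real_derivative 0) (at 0)"
      using flat_tendsto_0[of "k + 1"] by (simp add: DERIV_def)
    then show ?thesis
      using 3 by (simp add: flat_def)
  qed
qed

text \<open>Differentiation raises \<open>k\<close>, hence the induction keeps it arbitrary. The
  affine argument covers both flanks of a bump, with slopes 1 and -1.\<close>

lemma Ck_on_flat: "Ck_on n (\<lambda>s. flat k (c * s + b)) S"
proof (induction n arbitrary: k)
  case 0
  have "continuous_on UNIV (flat k)"
    by (meson DERIV_flat DERIV_isCont continuous_at_imp_continuous_on)
  then have "continuous_on S (flat k \<circ> (\<lambda>s. c * s + b))"
    by (intro continuous_on_compose continuous_intros) (auto intro: continuous_on_subset)
  then show ?case by (simp add: o_def)
next
  case (Suc n)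
  have "((\<lambda>s. flat k (c * s + b)) has_derivative
      (\<lambda>d. (d * c) * (flat (k + 2) (c * x + b) - real k * flat (k + 1) (c * x + b)))) (at x within S)" for x
  proof -
    have "((\<lambda>s. c * s + b) has_real_derivative c) (at x within S)"
      by (auto intro!: derivative_eq_intros)
    from DERIV_chain'[OF this DERIV_flat[of k "c * x + b"]] show ?thesis
      unfolding has_field_derivative_def
      by (rule has_derivative_eq_rhs) (simp add: fun_eq_iff mult_ac)
  qed
  moreover have "Ck_on n (\<lambda>x. (d * c) * (flat (k + 2) (c * x + b) - real k * flat (k + 1) (c * x + b))) S"
    for d
    by (intro Ck_on_mult Ck_on_diff Ck_on_const Suc.IH)
  ultimately show ?case
    by (auto intro!: exI[of _ "\<lambda>x d. (d * c) * (flat (k + 2) (c * x + b) - real k * flat (k + 1) (c * x + b))"])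
qed

lemma exists_bump:
  obtains \<phi> :: "real \<Rightarrow> real" where "\<And>k S. Ck_on k \<phi> S"
    "\<And>s. a < s \<Longrightarrow> s < b \<Longrightarrow> \<phi> s > 0" "\<And>s. \<not> (a < s \<and> s < b) \<Longrightarrow> \<phi> s = 0"
proof
  let ?\<phi> = "\<lambda>s. flat 0 (1 * s + - a) * flat 0 ((-1) * s + b)"
  show "Ck_on k ?\<phi> S" for k S
    by (intro Ck_on_mult Ck_on_flat)
qed (auto simp: flat_def)

section \<open>Symmetry of second derivatives\<close>

lemma DERIV_along_line:
  fixes G :: "'a::real_normed_vector \<Rightarrow> real"
  assumes "(G has_derivative G') (at (x + t *\<^sub>R d))"
  shows "((\<lambda>t. G (x + t *\<^sub>R d)) has_real_derivative G' d) (at t)"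
proof -
  have "((\<lambda>t. x + t *\<^sub>R d) has_derivative (\<lambda>h. h *\<^sub>R d)) (at t)"
    by (auto intro!: derivative_eq_intros)
  from has_derivative_compose[OF this assms] show ?thesis
    unfolding has_field_derivative_def
    by (rule has_derivative_eq_rhs)
      (simp add: fun_eq_iff linear_cmul[OF has_derivative_linear[OF assms]])
qed

text \<open>The mean value theorem is applied twice: in direction \<open>d\<close> to the difference
  of \<open>F\<close> along two parallel segments, then in direction \<open>e\<close> to the
  resulting difference of \<open>F'\<close>.\<close>

lemma second_difference_mvt:
  fixes F :: "'a::real_normed_vector \<Rightarrow> real"
  assumes F1: "\<And>y. y \<in> ball x r \<Longrightarrow> (F has_derivative F' y) (at y)"
    and F2: "\<And>y. y \<in> ball x r \<Longrightarrow> ((\<lambda>y. F' y d) has_derivative M y) (at y)"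
    and h: "h > 0" "h * (norm d + norm e) < r"
  obtains y where "y \<in> ball x r"
    "F (x + h *\<^sub>R d + h *\<^sub>R e) - F (x + h *\<^sub>R d) - F (x + h *\<^sub>R e) + F x = h * h * M y e"
proof -
  have inb: "x + s *\<^sub>R d + t *\<^sub>R e \<in> ball x r" if "0 \<le> s" "s \<le> h" "0 \<le> t" "t \<le> h" for s t
  proof -
    have "norm (s *\<^sub>R d + t *\<^sub>R e) \<le> s * norm d + t * norm e"
      using that norm_triangle_ineq[of "s *\<^sub>R d" "t *\<^sub>R e"] by simp
    also have "\<dots> \<le> h * norm d + h * norm e"
      using that by (intro add_mono mult_right_mono) auto
    finally have "norm (s *\<^sub>R d + t *\<^sub>R e) < r"
      using h by (simp add: distrib_left)
    moreover have "x - (x + s *\<^sub>R d + t *\<^sub>R e) = - (s *\<^sub>R d + t *\<^sub>R e)" by simp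
    ultimately show ?thesis
      by (simp only: mem_ball dist_norm norm_minus_cancel)
  qed
  have "\<exists>z. 0 < z \<and> z < h \<and>
      (F ((x + h *\<^sub>R e) + h *\<^sub>R d) - F (x + h *\<^sub>R d)) - (F ((x + h *\<^sub>R e) + 0 *\<^sub>R d) - F (x + 0 *\<^sub>R d))
      = (h - 0) * (F' ((x + h *\<^sub>R e) + z *\<^sub>R d) d - F' (x + z *\<^sub>R d) d)"
  proof (rule MVT2[OF h(1)])
    fix t assume t: "0 \<le> t" "t \<le> h"
    have "((\<lambda>t. F ((x + h *\<^sub>R e) + t *\<^sub>R d)) has_real_derivative F' ((x + h *\<^sub>R e) + t *\<^sub>R d) d) (at t)"
      using inb[of t h] t h by (intro DERIV_along_line F1) (simp add: add_ac)
    moreover have "((\<lambda>t. F (x + t *\<^sub>R d)) has_real_derivative F' (x + t *\<^sub>R d) d) (at t)"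
      using inb[of t 0] t h by (intro DERIV_along_line F1) simp
    ultimately show "((\<lambda>t. F ((x + h *\<^sub>R e) + t *\<^sub>R d) - F (x + t *\<^sub>R d)) has_real_derivative
        F' ((x + h *\<^sub>R e) + t *\<^sub>R d) d - F' (x + t *\<^sub>R d) d) (at t)"
      by (rule DERIV_diff)
  qed
  then obtain z where z: "0 < z" "z < h" and
    *: "F (x + h *\<^sub>R e + h *\<^sub>R d) - F (x + h *\<^sub>R d) - (F (x + h *\<^sub>R e) - F x)
      = h * (F' (x + h *\<^sub>R e + z *\<^sub>R d) d - F' (x + z *\<^sub>R d) d)"
    by auto
  have "\<exists>w. 0 < w \<and> w < h \<and>
      F' ((x + z *\<^sub>R d) + h *\<^sub>R e) d - F' ((x + z *\<^sub>R d) + 0 *\<^sub>R e) d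
      = (h - 0) * M ((x + z *\<^sub>R d) + w *\<^sub>R e) e"
    using inb z by (intro MVT2[OF h(1)] DERIV_along_line F2) auto
  then obtain w where w: "0 < w" "w < h" and
    "F' (x + z *\<^sub>R d + h *\<^sub>R e) d - F' (x + z *\<^sub>R d) d = h * M (x + z *\<^sub>R d + w *\<^sub>R e) e"
    by auto
  with * have "F (x + h *\<^sub>R d + h *\<^sub>R e) - F (x + h *\<^sub>R d) - F (x + h *\<^sub>R e) + F x
      = h * h * M (x + z *\<^sub>R d + w *\<^sub>R e) e"
    by (simp add: add_ac)
  then show thesis
    using inb[of z w] z w by (intro that[of "x + z *\<^sub>R d + w *\<^sub>R e"]) auto
qed

text \<open>The second difference does not change when \<open>d\<close> and \<open>e\<close> are
  swapped. The two orders of the mean value argument thus equate \<open>M y d e\<close> and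
  \<open>M z e d\<close> at points near \<open>x\<close>, and continuity brings both within half the
  supposed gap of their values at \<open>x\<close>.\<close>

lemma second_derivative_symmetric:
  fixes F :: "'a::real_normed_vector \<Rightarrow> real"
  assumes "open T" "x \<in> T"
    and F1: "\<And>y. y \<in> T \<Longrightarrow> (F has_derivative F' y) (at y)"
    and F2: "\<And>y d. y \<in> T \<Longrightarrow> ((\<lambda>y. F' y d) has_derivative M y d) (at y)"
    and cont: "\<And>d e. continuous_on T (\<lambda>y. M y d e)"
  shows "M x d e = M x e d"
proof (rule ccontr)
  assume ne: "M x d e \<noteq> M x e d"
  define \<epsilon> where "\<epsilon> = \<bar>M x d e - M x e d\<bar> / 2"
  have "\<epsilon> > 0" using ne by (simp add: \<epsilon>_def)
  have *: "\<exists>r>0. \<forall>y\<in>ball x r. y \<in> T \<and> \<bar>M y d e - M x d e\<bar> < \<epsilon>" for d e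
  proof -
    have "isCont (\<lambda>y. M y d e) x"
      using cont assms(1,2) continuous_on_eq_continuous_at by blast
    then have "\<forall>\<^sub>F y in nhds x. dist (M y d e) (M x d e) < \<epsilon>"
      using \<open>\<epsilon> > 0\<close> by (auto simp: isCont_def tendsto_iff eventually_nhds_conv_at)
    moreover have "\<forall>\<^sub>F y in nhds x. y \<in> T"
      using assms(1,2) by (rule eventually_nhds_in_open)
    ultimately have "\<forall>\<^sub>F y in nhds x. y \<in> T \<and> \<bar>M y d e - M x d e\<bar> < \<epsilon>"
      by eventually_elim (simp add: dist_real_def)
    then show ?thesis
      by (auto simp: eventually_nhds_metric dist_commute)
  qed
  obtain r1 where r1: "r1 > 0" "\<forall>y\<in>ball x r1. y \<in> T \<and> \<bar>M y d e - M x d e\<bar> < \<epsilon>" using * by blast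
  obtain r2 where r2: "r2 > 0" "\<forall>y\<in>ball x r2. y \<in> T \<and> \<bar>M y e d - M x e d\<bar> < \<epsilon>" using * by blast
  \<comment> \<open>The \<open>+ 1\<close> keeps the denominator positive and makes the bounds below
    strict.\<close>
  define h where "h = min r1 r2 / (norm d + norm e + 1)"
  have "h > 0"
    using r1(1) r2(1) by (auto simp: h_def intro!: divide_pos_pos add_nonneg_pos)
  have "h * (norm d + norm e) < h * (norm d + norm e + 1)"
    using \<open>h > 0\<close> by simp
  also have "\<dots> = min r1 r2"
    using add_nonneg_pos[of "norm d + norm e" 1] by (simp add: h_def)
  finally have hr: "h * (norm d + norm e) < r1" "h * (norm e + norm d) < r2"
    by (auto simp: add.commute)
  obtain y where y: "y \<in> ball x r1"
    "F (x + h *\<^sub>R d + h *\<^sub>R e) - F (x + h *\<^sub>R d) - F (x + h *\<^sub>R e) + F x = h * h * M y d e"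
    using r1 second_difference_mvt[OF F1 F2 \<open>h > 0\<close> hr(1)] by blast
  obtain z where z: "z \<in> ball x r2"
    "F (x + h *\<^sub>R e + h *\<^sub>R d) - F (x + h *\<^sub>R e) - F (x + h *\<^sub>R d) + F x = h * h * M z e d"
    using r2 second_difference_mvt[OF F1 F2 \<open>h > 0\<close> hr(2)] by blast
  have "h * h * M y d e = h * h * M z e d"
    using y(2) z(2) unfolding add.assoc add.commute[of "h *\<^sub>R e" "h *\<^sub>R d"] by linarith
  then have "M y d e = M z e d" using \<open>h > 0\<close> by simp
  moreover have "\<bar>M y d e - M x d e\<bar> < \<epsilon>" "\<bar>M z e d - M x e d\<bar> < \<epsilon>"
    using y(1) z(1) r1 r2 by auto
  ultimately show False unfolding \<epsilon>_def by (smt (verit) field_sum_of_halves)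
qed

section \<open>Variational lemmas on the unit interval\<close>

text \<open>On the line a derivative is determined by its value in direction 1.\<close>

lemma Ck_on_SucD_vector:
  fixes f :: "real \<Rightarrow> 'b::real_normed_vector"
  assumes "Ck_on (Suc k) f S"
  obtains g where "\<And>s. s \<in> S \<Longrightarrow> (f has_vector_derivative g s) (at s within S)" "Ck_on k g S"
proof -
  obtain f' where f': "\<forall>x\<in>S. (f has_derivative f' x) (at x within S)" "\<forall>d. Ck_on k (\<lambda>x. f' x d) S"
    using assms by auto
  show thesis
  proof
    show "(f has_vector_derivative f' s 1) (at s within S)" if "s \<in> S" for s
    proof -
      have D: "(f has_derivative f' s) (at s within S)" using f' that by blast
      then show ?thesis
        unfolding has_vector_derivative_def
      proof (rule has_derivative_eq_rhs)
        show "f' s = (\<lambda>h. h *\<^sub>R f' s 1)"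
        proof
          show "f' s h = h *\<^sub>R f' s 1" for h
            using linear_cmul[OF has_derivative_linear[OF D], of h 1] by simp
        qed
      qed
    qed
  qed (use f' in blast)
qed

lemma deriv01_eq:
  assumes "(u has_vector_derivative u') (at s within {0..1})" "s \<in> {0..1}"
  shows "deriv01 u s = u'"
  unfolding deriv01_def using assms vector_derivative_within_cbox[of 0 1 s u u'] by auto

text \<open>The definite description in \<open>grad\<close> denotes the Riesz vector of the
  derivative, which is \<open>adjoint f' 1\<close>; uniqueness of derivatives makes it the only
  candidate.\<close>

lemma grad_inner:
  fixes f :: "'a::euclidean_space \<Rightarrow> real"
  assumes "(f has_derivative f') (at x)"
  shows "grad f x \<bullet> w = f' w"
proof -
  have f': "h \<bullet> adjoint f' 1 = f' h" for h
    using adjoint_works[OF has_derivative_linear[OF assms], of h 1] by simp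
  have "grad f x = adjoint f' 1"
    unfolding grad_def
  proof (rule the_equality)
    show "GDERIV f x :> adjoint f' 1"
      using assms by (simp add: gderiv_def f')
    fix D assume "GDERIV f x :> D"
    then have "(\<lambda>h. h \<bullet> D) = f'"
      using assms unfolding gderiv_def by (rule has_derivative_unique)
    then have "\<forall>h. h \<bullet> D = h \<bullet> adjoint f' 1"
      unfolding f' by (simp add: fun_eq_iff)
    then show "D = adjoint f' 1"
      by (simp only: vector_eq_ldot)
  qed
  then show ?thesis using f'[of w] by (simp add: inner_commute)
qed

text \<open>If \<open>g t\<close> were nonzero, \<open>g\<close> would keep its sign near
  \<open>t\<close>, and a bump supported there would give a nonzero integral. Test functions vanish
  outside some \<open>{a..b}\<close> inside the open interval, as compactly supported variations
  require.\<close>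

lemma fundamental_lemma_variations:
  fixes g :: "real \<Rightarrow> real"
  assumes cont: "continuous_on {0..1} g"
    and int: "\<And>\<phi> a b. \<lbrakk>\<And>k. Ck_on k \<phi> {0..1}; 0 < a; b < 1; \<And>s. s \<notin> {a..b} \<Longrightarrow> \<phi> s = 0\<rbrakk> \<Longrightarrow>
      integral {0..1} (\<lambda>s. \<phi> s * g s) = 0"
    and t: "t \<in> {0<..<1}"
  shows "g t = 0"
proof (rule ccontr)
  assume "g t \<noteq> 0"
  have "isCont g t"
    using continuous_on_interior[OF cont] t by (simp add: interior_atLeastAtMost_real)
  then have "\<forall>\<^sub>F s in nhds t. g s * g t > 0"
    using \<open>g t \<noteq> 0\<close> unfolding isCont_def tendsto_at_iff_tendsto_nhds
    by (intro order_tendstoD(1)[OF tendsto_mult_right[of g "g t" _ "g t"]])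
      (auto simp: zero_less_mult_iff)
  moreover have "\<forall>\<^sub>F s in nhds t. s \<in> {0<..<1}"
    using t by (intro eventually_nhds_in_open) auto
  ultimately have "\<forall>\<^sub>F s in nhds t. g s * g t > 0 \<and> s \<in> {0<..<1}"
    by eventually_elim auto
  then obtain \<delta> where \<delta>: "\<delta> > 0" "\<And>s. \<bar>s - t\<bar> < \<delta> \<Longrightarrow> g s * g t > 0 \<and> s \<in> {0<..<1}"
    by (auto simp: eventually_nhds_metric dist_real_def)
  \<comment> \<open>Half of \<delta> keeps the end points themselves inside the neighbourhood, hence
    inside the open unit interval.\<close>
  define a b where "a = t - \<delta> / 2" and "b = t + \<delta> / 2"
  have ab: "0 < a" "b < 1" "a < t" "t < b"
    using \<delta>(2)[of a] \<delta>(2)[of b] \<open>\<delta> > 0\<close> by (auto simp: a_def b_def)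
  have pos: "g s * g t > 0" if "a < s" "s < b" for s
    using that \<delta>(2)[of s] by (auto simp: a_def b_def abs_if)
  obtain \<phi> :: "real \<Rightarrow> real" where \<phi>: "\<And>k S. Ck_on k \<phi> S"
    "\<And>s. a < s \<Longrightarrow> s < b \<Longrightarrow> \<phi> s > 0" "\<And>s. \<not> (a < s \<and> s < b) \<Longrightarrow> \<phi> s = 0"
    using exists_bump[of a b] by blast
  have "integral {0..1} (\<lambda>s. \<phi> s * g s) = 0"
    using \<phi> ab by (intro int[of \<phi> a b]) auto
  \<comment> \<open>The constant factor \<open>g t\<close> makes the integrand nonnegative whatever
    the sign of \<open>g\<close>.\<close>
  then have "integral {0..1} (\<lambda>s. \<phi> s * g s * g t) = 0"
    by (simp add: integral_mult_left)
  moreover have "continuous_on {0..1} (\<lambda>s. \<phi> s * g s * g t)"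
    using \<phi>(1)[of 0] cont by (intro continuous_intros) auto
  moreover have "\<phi> s * g s * g t \<ge> 0" for s
    using \<phi>(2)[of s] \<phi>(3)[of s] pos[of s] by (cases "a < s \<and> s < b") (auto simp: mult.assoc)
  ultimately have "\<phi> t * g t * g t = 0"
    using integral_eq_0_iff[of 0 1 "\<lambda>s. \<phi> s * g s * g t"] t by auto
  then show False
    using \<phi>(2)[of t] ab \<open>g t \<noteq> 0\<close> by simp
qed

lemma linear_euclidean_sum:
  fixes f :: "'a::euclidean_space \<Rightarrow> real"
  assumes "linear f"
  shows "f x = (\<Sum>b\<in>Basis. (x \<bullet> b) * f b)"
proof -
  have "f x = f (\<Sum>b\<in>Basis. (x \<bullet> b) *\<^sub>R b)"
    by (simp add: euclidean_representation)
  then show ?thesis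
    by (simp add: linear_sum[OF assms] linear_cmul[OF assms])
qed

text \<open>In dimension above one the space stays connected when the origin is removed.\<close>

lemma has_derivative_zero_punctured:
  fixes f :: "real^'n \<Rightarrow> real"
  assumes "CARD('n) > 1" and "\<And>p. p \<noteq> 0 \<Longrightarrow> (f has_derivative (\<lambda>h. 0)) (at p)"
    and "p \<noteq> 0" "q \<noteq> 0"
  shows "f p = f q"
proof (rule has_derivative_zero_unique_connected[where f = f and x = p and y = q and s = "UNIV - {0}"])
  show "open (UNIV - {0 :: real^'n})"
    by (intro open_Diff open_UNIV closed_singleton)
  show "connected (UNIV - {0 :: real^'n})"
    using assms(1) by (intro connected_open_delete) auto
qed (use assms in auto)

section \<open>Lagrangians of class C2\<close>

abbreviation jets :: "(real \<times> (real^'n) \<times> (real^'n)) set" where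
  "jets \<equiv> {0..1} \<times> UNIV \<times> (UNIV - {0})"

abbreviation interior_jets :: "(real \<times> (real^'n) \<times> (real^'n)) set" where
  "interior_jets \<equiv> {0<..<1} \<times> UNIV \<times> (UNIV - {0})"

lemma open_interior_jets: "open interior_jets"
  by (intro open_Times open_greaterThanLessThan open_UNIV open_Diff closed_singleton)

text \<open>\<open>F' x d\<close> is the derivative of \<open>L\<close> at \<open>x = (s, u, p)\<close> in direction \<open>d\<close>, and \<open>M x d e\<close> that of
  \<open>\<lambda>x. F' x d\<close> in direction \<open>e\<close>; linearity in \<open>d\<close> is only available where \<open>M\<close> is symmetric, that is,
  for \<open>0 < s < 1\<close>.\<close>

locale C2_lagrangian =
  fixes L :: "real \<Rightarrow> real^'n \<Rightarrow> real^'n \<Rightarrow> real"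
    and F' :: "real \<times> (real^'n) \<times> (real^'n) \<Rightarrow> real \<times> (real^'n) \<times> (real^'n) \<Rightarrow> real"
    and M :: "real \<times> (real^'n) \<times> (real^'n) \<Rightarrow> real \<times> (real^'n) \<times> (real^'n) \<Rightarrow> real \<times> (real^'n) \<times> (real^'n) \<Rightarrow> real"
  assumes D1: "\<And>x. x \<in> jets \<Longrightarrow> ((\<lambda>(s, u, p). L s u p) has_derivative F' x) (at x within jets)"
    and D2: "\<And>x d. x \<in> jets \<Longrightarrow> ((\<lambda>x. F' x d) has_derivative M x d) (at x within jets)"
    and cont_M: "\<And>d e. continuous_on jets (\<lambda>x. M x d e)"
begin

text \<open>The Euler--Lagrange expression paired with \<open>w\<close>; \<open>a\<close> stands for the second derivative of the curve.\<close>

definition EL :: "real \<times> (real^'n) \<times> (real^'n) \<Rightarrow> real^'n \<Rightarrow> real^'n \<Rightarrow> real" where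
  "EL x a w = F' x (0, w, 0) - M x (0, 0, w) (1, snd (snd x), a)"

lemma linear_F': "x \<in> jets \<Longrightarrow> linear (F' x)"
  using D1 has_derivative_linear by blast

lemma linear_M: "x \<in> jets \<Longrightarrow> linear (M x d)"
  using D2 has_derivative_linear by blast

text \<open>Derivatives of \<open>F' x d\<close> are given for fixed \<open>d\<close> only, so a
  varying direction is resolved into basis vectors.\<close>

lemma F'_expand:
  assumes "x \<in> jets"
  shows "F' x (0, v, 0) = (\<Sum>b\<in>Basis. (v \<bullet> b) * F' x (0, b, 0))"
    and "F' x (0, 0, v) = (\<Sum>b\<in>Basis. (v \<bullet> b) * F' x (0, 0, b))"
proof -
  have 1: "linear (\<lambda>v. F' x (0, v, 0))" and 2: "linear (\<lambda>v. F' x (0, 0, v))"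
    by (rule linear_compose[OF _ linear_F'[OF assms], unfolded o_def], rule linearI, simp, simp)+
  show "F' x (0, v, 0) = (\<Sum>b\<in>Basis. (v \<bullet> b) * F' x (0, b, 0))"
    by (rule linear_euclidean_sum[OF 1])
  show "F' x (0, 0, v) = (\<Sum>b\<in>Basis. (v \<bullet> b) * F' x (0, 0, b))"
    by (rule linear_euclidean_sum[OF 2])
qed

section \<open>Partial gradients of the Lagrangian\<close>

lemma grad_u:
  assumes "(s, u, p) \<in> jets"
  shows "grad (\<lambda>w. L s w p) u \<bullet> w = F' (s, u, p) (0, w, 0)"
proof (rule grad_inner)
  have "((\<lambda>w. (\<lambda>(s, u, p). L s u p) (s, w, p)) has_derivative (\<lambda>y. F' (s, u, p) (0, y, 0))) (at u)"
    using assms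
    by (intro has_derivative_in_compose2[of jets "\<lambda>(s, u, p). L s u p" F' "\<lambda>w. (s, w, p)"])
      (auto intro!: D1 derivative_eq_intros)
  then show "((\<lambda>w. L s w p) has_derivative (\<lambda>y. F' (s, u, p) (0, y, 0))) (at u)"
    by simp
qed

lemma grad_p:
  assumes "(s, u, p) \<in> jets"
  shows "grad (\<lambda>p. L s u p) p \<bullet> w = F' (s, u, p) (0, 0, w)"
proof (rule grad_inner)
  have "((\<lambda>p. (\<lambda>(s, u, p). L s u p) (s, u, p)) has_derivative (\<lambda>y. F' (s, u, p) (0, 0, y)))
      (at p within (UNIV - {0}))"
    using assms
    by (intro has_derivative_in_compose2[of jets "\<lambda>(s, u, p). L s u p" F' "\<lambda>p. (s, u, p)"])
      (auto intro!: D1 derivative_eq_intros)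
  then show "((\<lambda>p. L s u p) has_derivative (\<lambda>y. F' (s, u, p) (0, 0, y))) (at p)"
    \<comment> \<open>The punctured space is open, so the derivative within it is the full
      one.\<close>
    using assms at_within_open[of p "UNIV - {0}"] by (simp add: open_Diff)
qed

section \<open>The first variation along a fixed regular curve\<close>

context
  fixes u u' u'' :: "real \<Rightarrow> real^'n"
  assumes u: "\<And>s. s \<in> {0..1} \<Longrightarrow> (u has_vector_derivative u' s) (at s within {0..1})"
    and u': "\<And>s. s \<in> {0..1} \<Longrightarrow> (u' has_vector_derivative u'' s) (at s within {0..1})"
    and u'': "continuous_on {0..1} u''"
    and regular: "\<And>s. s \<in> {0..1} \<Longrightarrow> u' s \<noteq> 0"
begin

text \<open>This is the chain rule for the jet of the curve, whose velocity is
  \<open>(1, u' s, u'' s)\<close>.\<close>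

lemma F'_along_curve:
  assumes "s \<in> {0..1}"
  shows "((\<lambda>s. F' (s, u s, u' s) d) has_real_derivative M (s, u s, u' s) d (1, u' s, u'' s))
    (at s within {0..1})"
proof -
  have X: "((\<lambda>s. (s, u s, u' s)) has_derivative (\<lambda>h. h *\<^sub>R (1, u' s, u'' s))) (at s within {0..1})"
    using u[OF assms] u'[OF assms] by (auto simp: has_vector_derivative_def intro!: derivative_eq_intros)
  have "((\<lambda>s. F' (s, u s, u' s) d) has_derivative (\<lambda>h. M (s, u s, u' s) d (h *\<^sub>R (1, u' s, u'' s))))
      (at s within {0..1})"
    by (rule has_derivative_in_compose2[where t = jets and g = "\<lambda>x. F' x d" and g' = "\<lambda>x. M x d", OF D2 _ assms X])
      (use regular in auto)
  then show ?thesis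
    unfolding has_field_derivative_def
    by (rule has_derivative_eq_rhs)
      (use assms regular[OF assms] in \<open>simp add: fun_eq_iff linear_cmul[OF linear_M] del: scaleR_Pair\<close>)
qed

lemma continuous_EL: "continuous_on {0..1} (\<lambda>s. EL (s, u s, u' s) (u'' s) w)"
proof -
  have cu: "continuous_on {0..1} u" "continuous_on {0..1} u'"
    by (rule continuous_on_vector_derivative, erule u, rule continuous_on_vector_derivative, erule u')
  have "continuous_on {0..1} (\<lambda>s. M (s, u s, u' s) d c)" for d c
    by (rule continuous_on_compose2[OF cont_M]) (use regular in \<open>auto intro!: continuous_intros cu\<close>)
  \<comment> \<open>Continuity of \<open>M\<close> is known in fixed directions only, so the moving
    velocity is expanded in the basis.\<close>
  then have "continuous_on {0..1}
      (\<lambda>s. \<Sum>c\<in>Basis. ((1, u' s, u'' s) \<bullet> c) * M (s, u s, u' s) (0, 0, w) c)"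
    by (intro continuous_intros cu u'')
  moreover have "M (s, u s, u' s) (0, 0, w) (1, u' s, u'' s)
      = (\<Sum>c\<in>Basis. ((1, u' s, u'' s) \<bullet> c) * M (s, u s, u' s) (0, 0, w) c)" if "s \<in> {0..1}" for s
    using regular that by (intro linear_euclidean_sum linear_M) auto
  ultimately have "continuous_on {0..1} (\<lambda>s. M (s, u s, u' s) (0, 0, w) (1, u' s, u'' s))"
    by (subst continuous_on_cong[OF refl]) auto
  moreover have "continuous_on {0..1} (\<lambda>s. F' (s, u s, u' s) (0, w, 0))"
    by (rule DERIV_continuous_on, erule F'_along_curve)
  ultimately show ?thesis
    unfolding EL_def snd_conv by (rule continuous_on_diff[rotated])
qed

text \<open>Integration by parts: \<open>P\<close> is the pairing of the gradient in p with
  \<open>v\<close>, which vanishes at both ends, and adding \<open>P'\<close> to the Euler-Lagrange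
  integrand restores the integrand of the first variation. The pairing stays a sum over the basis
  because linearity of \<open>EL\<close> in its last argument is established only for 0 < s <
  1.\<close>

lemma first_variation_EL:
  assumes v: "\<And>s. s \<in> {0..1} \<Longrightarrow> (v has_vector_derivative v' s) (at s within {0..1})"
    and v0: "v 0 = 0" "v 1 = 0"
  shows "first_variation L u v =
    integral {0..1} (\<lambda>s. \<Sum>b\<in>Basis. (v s \<bullet> b) * EL (s, u s, u' s) (u'' s) b)"
proof -
  define P where "P s = (\<Sum>b\<in>Basis. (v s \<bullet> b) * F' (s, u s, u' s) (0, 0, b))" for s
  define P' where "P' s = (\<Sum>b\<in>Basis. (v' s \<bullet> b) * F' (s, u s, u' s) (0, 0, b) +
    (v s \<bullet> b) * M (s, u s, u' s) (0, 0, b) (1, u' s, u'' s))" for s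
  have vb: "((\<lambda>s. v s \<bullet> b) has_real_derivative v' s \<bullet> b) (at s within {0..1})" if "s \<in> {0..1}" for s b
    using bounded_linear.has_vector_derivative[OF bounded_linear_inner_left v[OF that], of b]
    by (simp add: has_real_derivative_iff_has_vector_derivative)
  have "(P has_real_derivative P' s) (at s within {0..1})" if "s \<in> {0..1}" for s
    unfolding P_def P'_def
    by (rule DERIV_sum, rule DERIV_cong[OF DERIV_mult[OF vb[OF that] F'_along_curve[OF that]]]) simp
  then have "(P' has_integral P 1 - P 0) {0..1}"
    by (intro fundamental_theorem_of_calculus)
      (auto simp: has_real_derivative_iff_has_vector_derivative)
  then have P': "(P' has_integral 0) {0..1}"
    by (simp add: P_def v0)
  have "continuous_on {0..1} v"
    by (rule continuous_on_vector_derivative) (erule v)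
  then have "continuous_on {0..1} (\<lambda>s. \<Sum>b\<in>Basis. (v s \<bullet> b) * EL (s, u s, u' s) (u'' s) b)" (is "continuous_on _ ?E")
    by (intro continuous_intros continuous_EL)
  then have "(?E has_integral integral {0..1} ?E) {0..1}"
    using integrable_continuous_real by blast
  from has_integral_add[OF this P']
  have "((\<lambda>s. ?E s + P' s) has_integral integral {0..1} ?E) {0..1}" by simp
  moreover have "?E s + P' s = grad (\<lambda>w. L s w (deriv01 u s)) (u s) \<bullet> v s +
      grad (\<lambda>p. L s (u s) p) (deriv01 u s) \<bullet> deriv01 v s" if "s \<in> {0..1}" for s
  proof -
    have X: "(s, u s, u' s) \<in> jets" using regular that by auto
    show ?thesis
      unfolding deriv01_eq[OF u[OF that] that] deriv01_eq[OF v[OF that] that] grad_u[OF X] grad_p[OF X]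
        F'_expand[OF X, of "v s"] F'_expand[OF X, of "v' s"] P'_def EL_def
      by (simp add: sum.distrib[symmetric] algebra_simps)
  qed
  ultimately show ?thesis
    unfolding first_variation_def by (intro integral_unique) (rule has_integral_eq[rotated])
qed

end

section \<open>Symmetry and linearity at interior parameters\<close>

lemma D1_interior: "x \<in> interior_jets \<Longrightarrow> ((\<lambda>(s, u, p). L s u p) has_derivative F' x) (at x)"
  using D1[of x] at_within_open_subset[OF _ open_interior_jets, of x jets] by fastforce

lemma D2_interior: "x \<in> interior_jets \<Longrightarrow> ((\<lambda>x. F' x d) has_derivative M x d) (at x)"
  using D2[of x] at_within_open_subset[OF _ open_interior_jets, of x jets] by fastforce

lemma M_sym:
  assumes "x \<in> interior_jets"
  shows "M x d e = M x e d"
  by (rule second_derivative_symmetric[OF open_interior_jets assms D1_interior D2_interior])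
    (auto intro: continuous_on_subset[OF cont_M])

lemma linear_M_left:
  assumes "x \<in> interior_jets"
  shows "linear (\<lambda>d. M x d e)"
proof -
  have "x \<in> jets" using assms by auto
  from linear_M[OF this, of e] show ?thesis
    by (subst M_sym[OF assms])
qed

lemma linear_EL:
  assumes "x \<in> interior_jets"
  shows "linear (EL x a)"
proof -
  have "x \<in> jets" using assms by auto
  have "linear (\<lambda>w. F' x (0, w, 0))"
    by (rule linear_compose[OF _ linear_F'[OF \<open>x \<in> jets\<close>], unfolded o_def], rule linearI, simp, simp)
  moreover have "linear (\<lambda>w. M x (0, 0, w) (1, snd (snd x), a))"
    by (rule linear_compose[OF _ linear_M_left[OF assms], unfolded o_def], rule linearI, simp, simp)
  ultimately have "linear (\<lambda>w. F' x (0, w, 0) - M x (0, 0, w) (1, snd (snd x), a))"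
    by (rule linear_compose_sub)
  then show ?thesis unfolding EL_def .
qed

section \<open>Consequences of the condition on normal variations\<close>

text \<open>The quadratic curve with position \<open>u0\<close>, velocity \<open>p\<close> and
  acceleration \<open>a\<close> at \<open>t\<close> is tested with bumps times a normal field. Since
  |s - t| <= 1 on the unit interval, \<open>norm a < norm p\<close> keeps the curve regular.\<close>

lemma EL_normal_small:
  assumes N: "N_lagrangian L" and t: "t \<in> {0<..<1}" and "p \<noteq> 0" and wp: "w \<bullet> p = 0"
    and small: "norm a < norm p"
  shows "EL (t, u0, p) a w = 0"
proof -
  define u where "u s = u0 + (s - t) *\<^sub>R p + ((s - t) * (s - t) / 2) *\<^sub>R a" for s
  define u' where "u' s = p + (s - t) *\<^sub>R a" for s
  \<comment> \<open>Up to the factor |u'|^2 this is the projection of \<open>w\<close> orthogonal to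
    \<open>u'\<close>. Without a division it is visibly smooth, and at \<open>t\<close> it equals
    |p|^2 times \<open>w\<close>.\<close>
  define W where "W s = (u' s \<bullet> u' s) *\<^sub>R w - (w \<bullet> u' s) *\<^sub>R u' s" for s
  define g where "g s = (\<Sum>b\<in>Basis. (W s \<bullet> b) * EL (s, u s, u' s) a b)" for s
  have du: "(u has_vector_derivative u' s) (at s within {0..1})" for s
  proof -
    have "((\<lambda>s. (s - t) * (s - t) / 2) has_real_derivative s - t) (at s within {0..1})"
      by (auto intro!: derivative_eq_intros)
    then show ?thesis
      unfolding u_def u'_def by (auto intro!: derivative_eq_intros)
  qed
  have du': "(u' has_vector_derivative a) (at s within {0..1})" for s
    unfolding u'_def by (auto intro!: derivative_eq_intros)
  have reg: "u' s \<noteq> 0" if "s \<in> {0..1}" for s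
  proof
    assume "u' s = 0"
    then have "norm p = norm ((s - t) *\<^sub>R a)"
      by (metis add_eq_0_iff norm_minus_cancel u'_def)
    also have "\<dots> \<le> 1 * norm a"
      unfolding norm_scaleR using that t by (intro mult_right_mono) auto
    finally show False using small by simp
  qed
  have Ck_u': "Ck_on k u' S" and Ck_u: "Ck_on k u S" for k S
  proof -
    have lin: "Ck_on k (\<lambda>s. s - t) S"
      by (intro Ck_on_diff Ck_on_const Ck_on_ident)
    then show "Ck_on k u' S"
      unfolding u'_def by (intro Ck_on_add Ck_on_scaleR Ck_on_const)
    have "Ck_on k (\<lambda>s. (s - t) * (s - t) * (1 / 2)) S"
      using lin by (intro Ck_on_mult Ck_on_const)
    with lin show "Ck_on k u S"
      unfolding u_def by (intro Ck_on_add Ck_on_scaleR Ck_on_const) auto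
  qed
  have Ck_W: "Ck_on k W S" for k S
    unfolding W_def by (intro Ck_on_diff Ck_on_scaleR Ck_on_inner Ck_on_const Ck_u')
  have C2R: "u \<in> C2R"
    using reg deriv01_eq[OF du] Ck_u by (auto simp: C2R_def simp del: Ck_on.simps)
  have "g t = 0"
  proof (rule fundamental_lemma_variations[OF _ _ t])
    have "continuous_on {0..1} W"
      using Ck_W[of 0] by simp
    then show "continuous_on {0..1} g"
      unfolding g_def
      by (intro continuous_intros continuous_EL[of u u' "\<lambda>s. a"] du du' reg continuous_on_const) auto
    fix \<phi> :: "real \<Rightarrow> real" and c d :: real
    assume \<phi>: "\<And>k. Ck_on k \<phi> {0..1}" and "0 < c" "d < 1" and \<phi>0: "\<And>s. s \<notin> {c..d} \<Longrightarrow> \<phi> s = 0"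
    define v where "v s = \<phi> s *\<^sub>R W s" for s
    have Ck_v: "Ck_on k v {0..1}" for k
      unfolding v_def by (intro Ck_on_scaleR \<phi> Ck_W)
    have supp: "closure {s \<in> {0..1}. v s \<noteq> 0} \<subseteq> {c..d}"
    proof (rule closure_minimal)
      show "{s \<in> {0..1}. v s \<noteq> 0} \<subseteq> {c..d}"
      proof (rule subsetI, rule ccontr)
        fix s assume "s \<in> {s \<in> {0..1}. v s \<noteq> 0}" "s \<notin> {c..d}"
        then show False using \<phi>0[of s] by (simp add: v_def)
      qed
    qed simp
    then have "compact (closure {s \<in> {0..1}. v s \<noteq> 0})"
      by (meson bounded_closed_interval bounded_subset closed_closure compact_eq_bounded_closed)
    moreover have "closure {s \<in> {0..1}. v s \<noteq> 0} \<subseteq> {0<..<1}"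
      using supp \<open>0 < c\<close> \<open>d < 1\<close> by fastforce
    ultimately have "v \<in> Cinf_c"
      using Ck_v by (auto simp: Cinf_c_def smooth_on_def)
    moreover have "v s \<bullet> deriv01 u s = 0" if "s \<in> {0..1}" for s
      using deriv01_eq[OF du that] by (simp add: v_def W_def inner_diff_left)
    ultimately have "v \<in> normal_variations u"
      by (simp add: normal_variations_def)
    with N C2R have "first_variation L u v = 0"
      by (auto simp: N_lagrangian_def)
    moreover obtain v' where "\<And>s. s \<in> {0..1} \<Longrightarrow> (v has_vector_derivative v' s) (at s within {0..1})"
      using Ck_on_SucD_vector[OF Ck_v[of "Suc 0"]] by blast
    then have "first_variation L u v =
        integral {0..1} (\<lambda>s. \<Sum>b\<in>Basis. (v s \<bullet> b) * EL (s, u s, u' s) a b)"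
      using \<phi>0[of 0] \<phi>0[of 1] \<open>0 < c\<close> \<open>d < 1\<close>
      by (intro first_variation_EL[of u u' "\<lambda>s. a"] du du' reg continuous_on_const) (auto simp: v_def)
    ultimately show "integral {0..1} (\<lambda>s. \<phi> s * g s) = 0"
      by (simp add: v_def g_def sum_distrib_left mult.assoc)
  qed
  moreover have "g t = (p \<bullet> p) * (\<Sum>b\<in>Basis. (w \<bullet> b) * EL (t, u0, p) a b)"
    by (simp add: g_def W_def u'_def u_def wp sum_distrib_left mult.assoc)
  moreover have "EL (t, u0, p) a w = (\<Sum>b\<in>Basis. (w \<bullet> b) * EL (t, u0, p) a b)"
    using t \<open>p \<noteq> 0\<close> by (intro linear_euclidean_sum linear_EL) auto
  ultimately show ?thesis
    using \<open>p \<noteq> 0\<close> by simp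
qed

text \<open>\<open>EL\<close> is affine in the acceleration, with the second derivative in p as its
  linear part; comparing its zeros at acceleration 0 and at a small multiple of \<open>a\<close>
  isolates that part.\<close>

lemma M_vertical_normal:
  assumes N: "N_lagrangian L" and t: "t \<in> {0<..<1}" and "p \<noteq> 0" and wp: "w \<bullet> p = 0"
  shows "M (t, u, p) (0, 0, w) (0, 0, a) = 0"
proof (cases "a = 0")
  case True
  have "(t, u, p) \<in> jets" using t \<open>p \<noteq> 0\<close> by auto
  from linear_0[OF linear_M[OF this]] True show ?thesis by (simp add: zero_prod_def)
next
  case False
  have J: "(t, u, p) \<in> jets" using t \<open>p \<noteq> 0\<close> by auto
  note lin = linear_M[OF J, of "(0, 0, w)"]
  define c where "c = norm p / (2 * norm a)"
  have "c > 0" "norm (c *\<^sub>R a) < norm p"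
    using False \<open>p \<noteq> 0\<close> by (auto simp: c_def)
  then have "EL (t, u, p) (c *\<^sub>R a) w = 0" "EL (t, u, p) 0 w = 0"
    using EL_normal_small[OF N t \<open>p \<noteq> 0\<close> wp] \<open>p \<noteq> 0\<close> by auto
  then have "M (t, u, p) (0, 0, w) (1, p, c *\<^sub>R a) = M (t, u, p) (0, 0, w) (1, p, 0)"
    by (simp add: EL_def)
  moreover have "M (t, u, p) (0, 0, w) (1, p, c *\<^sub>R a)
      = M (t, u, p) (0, 0, w) ((1, p, 0) + c *\<^sub>R (0, 0, a))"
    by simp
  ultimately have "c * M (t, u, p) (0, 0, w) (0, 0, a) = 0"
    unfolding linear_add[OF lin] linear_cmul[OF lin] by simp
  then show ?thesis using \<open>c > 0\<close> by simp
qed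

lemma F'_vertical_deriv:
  assumes "t \<in> {0<..<1}" "p \<noteq> 0"
  shows "((\<lambda>p. F' (t, u, p) d) has_derivative (\<lambda>q. M (t, u, p) d (0, 0, q))) (at p)"
proof -
  have "((\<lambda>p. (t, u, p)) has_derivative (\<lambda>q. (0, 0, q))) (at p)"
    by (auto intro!: derivative_eq_intros)
  from has_derivative_compose[OF this D2_interior] assms show ?thesis by auto
qed

text \<open>For \<open>w\<close> orthogonal to \<open>p\<close> the second derivative in \<open>p\<close> kills \<open>w\<close>, so the gradient in \<open>p\<close> is
  constant on spheres. Its radial derivatives at orthogonal points \<open>p\<close> and \<open>q\<close> of equal norm
  therefore agree, while one is parallel to \<open>p\<close> and the other to \<open>q\<close>.\<close>

lemma M_vertical_radial:
  assumes N: "N_lagrangian L" and t: "t \<in> {0<..<1}" and "p \<noteq> 0" and n: "CARD('n) > 1"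
  shows "M (t, u, p) (0, 0, p) (0, 0, p) = 0"
proof -
  obtain y :: "real^'n" where y: "y \<noteq> 0" "orthogonal p y"
    using orthogonal_to_vector_exists[of p] n by auto
  \<comment> \<open>Dimension above one provides \<open>y\<close>; rescaling puts \<open>q\<close>
    on the sphere through \<open>p\<close>.\<close>
  define q where "q = (norm p / norm y) *\<^sub>R y"
  have q: "q \<noteq> 0" "p \<bullet> q = 0" "q \<bullet> q = p \<bullet> p"
    using y \<open>p \<noteq> 0\<close> by (auto simp: q_def orthogonal_def dot_square_norm power_divide power2_eq_square)
  define G where "G v = F' (t, u, v) (0, 0, p)" for v
  have G: "(G has_derivative (\<lambda>z. M (t, u, v) (0, 0, p) (0, 0, z))) (at v)" if "v \<noteq> 0" for v
    unfolding G_def using t that by (rule F'_vertical_deriv)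
  have spheres: "G (r *\<^sub>R p) = G (r *\<^sub>R q)" if "r > 0" for r
  proof -
    \<comment> \<open>The curve \<open>c\<close> is a circle passing \<open>r *\<^sub>R p\<close> at
      angle 0 and \<open>r *\<^sub>R q\<close> at pi/2; \<open>c'\<close> is its velocity.\<close>
    define c where "c \<theta> = (r * cos \<theta>) *\<^sub>R p + (r * sin \<theta>) *\<^sub>R q" for \<theta>
    define c' where "c' \<theta> = (- r * sin \<theta>) *\<^sub>R p + (r * cos \<theta>) *\<^sub>R q" for \<theta>
    have c: "c \<theta> \<noteq> 0" for \<theta>
    proof -
      have "c \<theta> \<bullet> c \<theta> = r\<^sup>2 * (cos \<theta>)\<^sup>2 * (p \<bullet> p) + r\<^sup>2 * (sin \<theta>)\<^sup>2 * (p \<bullet> p)"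
        unfolding c_def using q
        by (simp add: inner_add_left inner_add_right inner_commute[of q p] power2_eq_square mult_ac)
      also have "\<dots> = r\<^sup>2 * ((cos \<theta>)\<^sup>2 + (sin \<theta>)\<^sup>2) * (p \<bullet> p)"
        by (simp only: distrib_left distrib_right)
      finally show ?thesis using that \<open>p \<noteq> 0\<close> by auto
    qed
    have perp: "c' \<theta> \<bullet> c \<theta> = 0" for \<theta>
      unfolding c_def c'_def using q
      by (simp add: inner_add_left inner_add_right inner_diff_left inner_commute[of q p])
    have "(c has_derivative (\<lambda>h. h *\<^sub>R c' \<theta>)) (at \<theta>)" for \<theta>
      unfolding c_def c'_def by (auto intro!: derivative_eq_intros simp: algebra_simps)
    from has_derivative_compose[OF this G[OF c]]
    have "((\<lambda>\<theta>. G (c \<theta>)) has_derivative (\<lambda>h. M (t, u, c \<theta>) (0, 0, p) (0, 0, h *\<^sub>R c' \<theta>))) (at \<theta>)" for \<theta> .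
    \<comment> \<open>Symmetry moves the tangent vector to the first slot, where it is orthogonal to
      the base point \<open>c \<theta>\<close>.\<close>
    moreover have "M (t, u, c \<theta>) (0, 0, p) (0, 0, h *\<^sub>R c' \<theta>) = 0" for \<theta> h
      using t c[of \<theta>] perp[of \<theta>]
      by (subst M_sym) (auto intro!: M_vertical_normal[OF N])
    ultimately have "DERIV (\<lambda>\<theta>. G (c \<theta>)) \<theta> :> 0" for \<theta>
      by (simp add: has_field_derivative_def lambda_zero)
    then have "G (c 0) = G (c (pi / 2))"
      by (intro DERIV_isconst_all) blast
    then show ?thesis by (simp add: c_def)
  qed
  have line: "((\<lambda>r. G (r *\<^sub>R v)) has_real_derivative M (t, u, v) (0, 0, p) (0, 0, v)) (at 1)"
    if "v \<noteq> 0" for v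
    using DERIV_along_line[of G _ 0 1 v] G[OF that] by simp
  \<comment> \<open>By \<open>spheres\<close> the two radial functions coincide for r > 0, hence so
    do their derivatives at 1.\<close>
  have "((\<lambda>r. G (r *\<^sub>R p)) has_real_derivative M (t, u, q) (0, 0, p) (0, 0, q)) (at 1)"
    by (rule has_field_derivative_transform_within_open[OF line[OF q(1)], of "{0<..}"])
      (use spheres in auto)
  then have "M (t, u, p) (0, 0, p) (0, 0, p) = M (t, u, q) (0, 0, p) (0, 0, q)"
    using line[OF \<open>p \<noteq> 0\<close>] DERIV_unique by blast
  \<comment> \<open>The base point is now \<open>q\<close>, to which the direction \<open>p\<close>
    is orthogonal.\<close>
  also have "\<dots> = 0"
    using q by (intro M_vertical_normal[OF N t])
  finally show ?thesis .
qed

text \<open>Splitting off the component orthogonal to \<open>p\<close> in one argument, and by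
  symmetry in the other, leaves only the radial-radial value.\<close>

lemma M_vertical:
  assumes N: "N_lagrangian L" and t: "t \<in> {0<..<1}" and "p \<noteq> 0" and n: "CARD('n) > 1"
  shows "M (t, u, p) (0, 0, w) (0, 0, a) = 0"
proof -
  have I: "(t, u, p) \<in> interior_jets" and J: "(t, u, p) \<in> jets" using t \<open>p \<noteq> 0\<close> by auto
  have *: "M (t, u, p) (0, 0, w) (0, 0, a) = (w \<bullet> p / (p \<bullet> p)) * M (t, u, p) (0, 0, p) (0, 0, a)" for w a
  proof -
    define w' where "w' = w - (w \<bullet> p / (p \<bullet> p)) *\<^sub>R p"
    have "w' \<bullet> p = 0" using \<open>p \<noteq> 0\<close> by (simp add: w'_def inner_diff_left)
    then have "M (t, u, p) (0, 0, w') (0, 0, a) = 0"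
      by (rule M_vertical_normal[OF N t \<open>p \<noteq> 0\<close>])
    moreover have "M (t, u, p) (0, 0, w) (0, 0, a)
        = M (t, u, p) ((0, 0, w') + (w \<bullet> p / (p \<bullet> p)) *\<^sub>R (0, 0, p)) (0, 0, a)"
      by (simp add: w'_def)
    ultimately show ?thesis
      unfolding linear_add[OF linear_M_left[OF I]] linear_cmul[OF linear_M_left[OF I]] by simp
  qed
  have "M (t, u, p) (0, 0, p) (0, 0, a) = 0"
    using *[of a p] M_vertical_radial[OF N t \<open>p \<noteq> 0\<close> n] M_sym[OF I] by simp
  then show ?thesis using *[of w a] by simp
qed

section \<open>Affine dependence on the velocity\<close>

lemma F'_vertical_indep:
  assumes N: "N_lagrangian L" and t: "t \<in> {0<..<1}" and n: "CARD('n) > 1" and "p \<noteq> 0" "q \<noteq> 0"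
  shows "F' (t, u, p) (0, 0, w) = F' (t, u, q) (0, 0, w)"
proof -
  have "((\<lambda>p. F' (t, u, p) (0, 0, w)) has_derivative (\<lambda>h. 0)) (at p)" if "p \<noteq> 0" for p
    using F'_vertical_deriv[OF t that, of u "(0, 0, w)"] M_vertical[OF N t that n] by simp
  then show ?thesis
    by (rule has_derivative_zero_punctured[OF n, of "\<lambda>p. F' (t, u, p) (0, 0, w)"]) (use assms in auto)
qed

text \<open>The gradient in p is the same function of (s, u) at every nonzero velocity, so its
  derivatives in s and u agree as well.\<close>

lemma M_mixed_indep:
  assumes N: "N_lagrangian L" and t: "t \<in> {0<..<1}" and n: "CARD('n) > 1" and "p \<noteq> 0" "q \<noteq> 0"
  shows "M (t, u, p) (0, 0, w) (c, d, 0) = M (t, u, q) (0, 0, w) (c, d, 0)"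
proof -
  have line: "((\<lambda>r. F' (t + r * c, u + r *\<^sub>R d, p) (0, 0, w)) has_real_derivative
      M (t, u, p) (0, 0, w) (c, d, 0)) (at 0)" if "p \<noteq> 0" for p
    using DERIV_along_line[of "\<lambda>x. F' x (0, 0, w)" "M (t, u, p) (0, 0, w)" "(t, u, p)" 0 "(c, d, 0)"]
      D2_interior[of "(t, u, p)" "(0, 0, w)"] t that by (simp del: zero_prod_def)
  \<comment> \<open>For \<open>r\<close> in this neighbourhood of 0 the shifted parameter stays in
    the open unit interval, where independence of the velocity holds.\<close>
  have "open ((\<lambda>r. t + r * c) -` {0<..<1})"
    by (intro open_vimage open_greaterThanLessThan continuous_intros)
  then have "((\<lambda>r. F' (t + r * c, u + r *\<^sub>R d, p) (0, 0, w)) has_real_derivative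
      M (t, u, q) (0, 0, w) (c, d, 0)) (at 0)"
    by (rule has_field_derivative_transform_within_open[OF line[OF \<open>q \<noteq> 0\<close>]])
      (use t in \<open>auto intro!: F'_vertical_indep[OF N _ n] assms\<close>)
  then show ?thesis
    using line[OF \<open>p \<noteq> 0\<close>] DERIV_unique by blast
qed

lemma EL_zero:
  assumes N: "N_lagrangian L" and t: "t \<in> {0<..<1}" and n: "CARD('n) > 1" and "p \<noteq> 0"
  shows "EL (t, u, p) a w = 0"
proof -
  \<comment> \<open>For L = A(s, u) + B(s, u) . p these are \<beta> w q = (B_u w) . q, \<gamma> w =
    B_s . w and \<alpha> w = A_u . w.\<close>
  define \<beta> where "\<beta> w q = M (t, u, p) (0, w, 0) (0, 0, q)" for w q
  define \<gamma> where "\<gamma> w = M (t, u, p) (0, 0, w) (1, 0, 0)" for w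
  define \<alpha> where "\<alpha> w = F' (t, u, p) (0, w, 0) - \<beta> w p" for w
  have I: "(t, u, r) \<in> interior_jets" and J: "(t, u, r) \<in> jets" if "r \<noteq> 0" for r
    using t that by auto
  have \<beta>_left: "linear (\<lambda>w. \<beta> w q)" for q
    unfolding \<beta>_def
    by (rule linear_compose[OF _ linear_M_left[OF I[OF \<open>p \<noteq> 0\<close>]], unfolded o_def], rule linearI, simp, simp)
  have \<beta>_right: "linear (\<beta> w)" for w
    unfolding \<beta>_def
    by (rule linear_compose[OF _ linear_M[OF J[OF \<open>p \<noteq> 0\<close>]], unfolded o_def], rule linearI, simp, simp)
  have M\<beta>: "M (t, u, r) (0, w, 0) (0, 0, q) = \<beta> w q" if "r \<noteq> 0" for r w q
    unfolding \<beta>_def M_sym[OF I[OF that], of "(0, w, 0)"] M_sym[OF I[OF \<open>p \<noteq> 0\<close>], of "(0, w, 0)"]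
    by (rule M_mixed_indep[OF N t n that \<open>p \<noteq> 0\<close>])
  \<comment> \<open>As a function of the velocity, the derivative in u has constant slope
    \<open>\<beta> w\<close>; subtracting that linear part leaves a constant on the punctured space,
    evaluated at \<open>p\<close>.\<close>
  have F'\<alpha>: "F' (t, u, r) (0, w, 0) = \<alpha> w + \<beta> w r" if "r \<noteq> 0" for r w
  proof -
    have "((\<lambda>r. F' (t, u, r) (0, w, 0) - \<beta> w r) has_derivative (\<lambda>h. 0)) (at r)" if "r \<noteq> 0" for r
    proof -
      have "((\<lambda>r. F' (t, u, r) (0, w, 0)) has_derivative \<beta> w) (at r)"
        using F'_vertical_deriv[OF t that, of u "(0, w, 0)"] M\<beta>[OF that] by simp
      from has_derivative_diff[OF this linear_imp_has_derivative[OF \<beta>_right[of w]]] show ?thesis by simp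
    qed
    then have "F' (t, u, r) (0, w, 0) - \<beta> w r = F' (t, u, p) (0, w, 0) - \<beta> w p"
      by (rule has_derivative_zero_punctured[OF n, of "\<lambda>r. F' (t, u, r) (0, w, 0) - \<beta> w r"])
        (use that \<open>p \<noteq> 0\<close> in auto)
    then show ?thesis by (simp add: \<alpha>_def)
  qed
  have EL: "EL (t, u, r) a w = (\<alpha> w - \<gamma> w) + (\<beta> w r - \<beta> r w)" if "r \<noteq> 0" for r a w
  proof -
    note lin = linear_M[OF J[OF that], of "(0, 0, w)"]
    have "M (t, u, r) (0, 0, w) (1, r, a)
        = M (t, u, r) (0, 0, w) ((1, 0, 0) + (0, r, 0) + (0, 0, a))"
      by simp
    also have "\<dots> = M (t, u, r) (0, 0, w) (1, 0, 0) + M (t, u, r) (0, 0, w) (0, r, 0)"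
      unfolding linear_add[OF lin] M_vertical[OF N t that n] by simp
    also have "M (t, u, r) (0, 0, w) (1, 0, 0) = \<gamma> w"
      unfolding \<gamma>_def by (rule M_mixed_indep[OF N t n that \<open>p \<noteq> 0\<close>])
    also have "M (t, u, r) (0, 0, w) (0, r, 0) = \<beta> r w"
      unfolding M_sym[OF I[OF that], of "(0, 0, w)"] by (rule M\<beta>[OF that])
    finally show ?thesis
      by (simp add: EL_def F'\<alpha>[OF that])
  qed
  \<comment> \<open>Passing from \<open>r\<close> to \<open>-r\<close> flips the sign of the \<beta>
    part only, so both parts vanish separately.\<close>
  have split: "\<alpha> w = \<gamma> w \<and> \<beta> w r = \<beta> r w" if "r \<noteq> 0" "w \<bullet> r = 0" for w r
  proof -
    have "EL (t, u, r) 0 w = 0" "EL (t, u, - r) 0 w = 0"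
      using that by (auto intro!: EL_normal_small[OF N t])
    then show ?thesis
      using that EL linear_neg[OF \<beta>_left] linear_neg[OF \<beta>_right] by auto
  qed
  \<comment> \<open>Every \<open>w\<close> is orthogonal to some nonzero vector, and neither side
    depends on the velocity.\<close>
  have "\<alpha> w = \<gamma> w"
  proof -
    obtain y :: "real^'n" where "y \<noteq> 0" "orthogonal w y"
      using orthogonal_to_vector_exists[of w] n by auto
    then show ?thesis using split[of y w] by (simp add: orthogonal_def)
  qed
  \<comment> \<open>Only the component of \<open>w\<close> orthogonal to \<open>p\<close> matters:
    on multiples of \<open>p\<close> the symmetry is trivial.\<close>
  moreover have "\<beta> w p = \<beta> p w"
  proof -
    define c where "c = w \<bullet> p / (p \<bullet> p)"
    define w' where "w' = w - c *\<^sub>R p"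
    have "w' \<bullet> p = 0" using \<open>p \<noteq> 0\<close> by (simp add: w'_def c_def inner_diff_left)
    then have "\<beta> w' p = \<beta> p w'" using split[OF \<open>p \<noteq> 0\<close>] by blast
    moreover have "w = w' + c *\<^sub>R p" by (simp add: w'_def)
    ultimately show ?thesis
      by (simp add: linear_add[OF \<beta>_left] linear_add[OF \<beta>_right] linear_cmul[OF \<beta>_left] linear_cmul[OF \<beta>_right])
  qed
  ultimately show ?thesis by (simp add: EL[OF \<open>p \<noteq> 0\<close>])
qed

text \<open>After integration by parts the integrand vanishes pointwise: inside the interval because
  \<open>EL\<close> does, at the two end points because the variation does.\<close>

lemma null_if_N_lagrangian:
  assumes N: "N_lagrangian L" and n: "CARD('n) > 1"
  shows "null_lagrangian L"
  unfolding null_lagrangian_def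
proof (intro ballI)
  fix u v :: "real \<Rightarrow> real^'n"
  assume u: "u \<in> C2R" and v: "v \<in> Cinf_c"
  have "Ck_on (Suc (Suc 0)) u {0..1}"
    using u by (simp add: C2R_def numeral_2_eq_2)
  then obtain u' where u': "\<And>s. s \<in> {0..1} \<Longrightarrow> (u has_vector_derivative u' s) (at s within {0..1})"
      "Ck_on (Suc 0) u' {0..1}"
    using Ck_on_SucD_vector by blast
  then obtain u'' where u'': "\<And>s. s \<in> {0..1} \<Longrightarrow> (u' has_vector_derivative u'' s) (at s within {0..1})"
      "Ck_on 0 u'' {0..1}"
    using Ck_on_SucD_vector[OF u'(2)] by blast
  have reg: "u' s \<noteq> 0" if "s \<in> {0..1}" for s
    using u deriv01_eq[OF u'(1)] that by (simp add: C2R_def)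
  have "Ck_on (Suc 0) v {0..1}"
    using v by (simp add: Cinf_c_def smooth_on_def del: Ck_on.simps)
  then obtain v' where v': "\<And>s. s \<in> {0..1} \<Longrightarrow> (v has_vector_derivative v' s) (at s within {0..1})"
    using Ck_on_SucD_vector by blast
  have v0: "v s = 0" if "s \<in> {0..1} - {0<..<1}" for s
  proof (rule ccontr)
    assume "v s \<noteq> 0"
    with that have "s \<in> closure {s \<in> {0..1}. v s \<noteq> 0}"
      by (intro closure_subset[THEN subsetD]) auto
    with v that show False
      unfolding Cinf_c_def by blast
  qed
  have "first_variation L u v =
      integral {0..1} (\<lambda>s. \<Sum>b\<in>Basis. (v s \<bullet> b) * EL (s, u s, u' s) (u'' s) b)"
    by (rule first_variation_EL[OF u'(1) u''(1) _ reg v']) (use u''(2) v0 in auto)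
  also have "\<dots> = 0"
  proof (rule integral_unique, rule has_integral_is_0)
    fix s :: real assume "s \<in> {0..1}"
    then have "(v s \<bullet> b) * EL (s, u s, u' s) (u'' s) b = 0" for b
      using v0[of s] EL_zero[OF N _ n reg, of s s] by (cases "s \<in> {0<..<1}") auto
    then show "(\<Sum>b\<in>Basis. (v s \<bullet> b) * EL (s, u s, u' s) (u'' s) b) = 0"
      by (simp only: sum.neutral_const)
  qed
  finally show "first_variation L u v = 0" .
qed

end

theorem corollary5p1:
  fixes L :: "real \<Rightarrow> real^'n \<Rightarrow> real^'n \<Rightarrow> real"
  assumes "CARD('n) > 1"
    and "lagrangian L"
    and "N_lagrangian L"
  shows "null_lagrangian L"
proof -
  have "Ck_on (Suc (Suc 0)) (\<lambda>(s, u, p). L s u p) jets"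
    using assms(2) by (simp only: lagrangian_def smooth_on_def)
  then obtain F' where F': "\<forall>x\<in>jets. ((\<lambda>(s, u, p). L s u p) has_derivative F' x) (at x within jets)"
      "\<forall>d. Ck_on (Suc 0) (\<lambda>x. F' x d) jets"
    unfolding Ck_on.simps(2)[of "Suc 0"] by blast
  \<comment> \<open>Each direction \<open>d\<close> comes with its own second derivative; the axiom
    of choice gathers them into one function of \<open>d\<close>.\<close>
  then have "\<forall>d. \<exists>m. (\<forall>x\<in>jets. ((\<lambda>x. F' x d) has_derivative m x) (at x within jets)) \<and>
      (\<forall>e. continuous_on jets (\<lambda>x. m x e))"
    by simp
  then obtain m where "\<forall>d. (\<forall>x\<in>jets. ((\<lambda>x. F' x d) has_derivative m d x) (at x within jets)) \<and>
      (\<forall>e. continuous_on jets (\<lambda>x. m d x e))"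
    by (rule choice[THEN exE])
  then have m: "\<And>x d. x \<in> jets \<Longrightarrow> ((\<lambda>x. F' x d) has_derivative m d x) (at x within jets)"
      "\<And>d e. continuous_on jets (\<lambda>x. m d x e)"
    by blast+
  interpret C2_lagrangian L F' "\<lambda>x d. m d x"
    by (rule C2_lagrangian.intro[OF bspec[OF F'(1)] m])
  show ?thesis
    using assms by (intro null_if_N_lagrangian)
qed

end
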